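(* For every positive integer $n$, with $m=2^n$, there exists a Latin square $L$ of dimension $m$ such that the non-deterministic communication complexity of the $3$-argument function $f_L$ is $n-O(1)$; that is, $N^1(f_L)=n-O(1)$ (with the $O(1)$ an absolute constant independent of $n$).
   Context: A Latin square of dimension $m$ is a matrix $L\in[m]^{m\times m}$ every row and every column of which is a permutation of $[m]$. For such $L$, identify $[m]$ with $\{0,1\}^n$ and define $f_L:[m]\times[m]\times[m]\to\{0,1\}$ by $f_L(x,y,z)=1$ iff $L[x,y]\neq z$. For a $3$-argument function $f$ (player $i$ holding the $i$-th argument), a $1$-monochromatic box is a set $X_1\times X_2\times X_3$ on which $f$ is identically $1$; a $1$-cover is a set of (possibly overlapping) $1$-monochromatic boxes whose union contains every input on which $f=1$; $C^1(f)$ is the minimum size of a $1$-cover, and the non-deterministic communication complexity is $N^1(f)=\log_2 C^1(f)$. *)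

theory Defs
  imports Complex_Main
begin

definition latin_square :: "nat \<Rightarrow> (nat \<Rightarrow> nat \<Rightarrow> nat) \<Rightarrow> bool" where
  "latin_square m L \<longleftrightarrow>
     (\<forall>x\<in>{1..m}. bij_betw (\<lambda>y. L x y) {1..m} {1..m}) \<and>
     (\<forall>y\<in>{1..m}. bij_betw (\<lambda>x. L x y) {1..m} {1..m})"

definition latin_fun :: "(nat \<Rightarrow> nat \<Rightarrow> nat) \<Rightarrow> nat \<Rightarrow> nat \<Rightarrow> nat \<Rightarrow> nat" where
  "latin_fun L x y z = (if L x y \<noteq> z then 1 else 0)"

(* The input sets A, B, C of the three players are explicit parameters; the
   values of f outside them are irrelevant. *)

definition mono1_box ::
  "'a set \<Rightarrow> 'b set \<Rightarrow> 'c set \<Rightarrow> ('a \<Rightarrow> 'b \<Rightarrow> 'c \<Rightarrow> nat) \<Rightarrow> ('a \<times> 'b \<times> 'c) set \<Rightarrow> bool" where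
  "mono1_box A B C f R \<longleftrightarrow>
     (\<exists>X Y Z. X \<subseteq> A \<and> Y \<subseteq> B \<and> Z \<subseteq> C \<and> R = X \<times> Y \<times> Z) \<and>
     (\<forall>(x, y, z)\<in>R. f x y z = 1)"

definition cover1 ::
  "'a set \<Rightarrow> 'b set \<Rightarrow> 'c set \<Rightarrow> ('a \<Rightarrow> 'b \<Rightarrow> 'c \<Rightarrow> nat) \<Rightarrow> ('a \<times> 'b \<times> 'c) set set \<Rightarrow> bool" where
  "cover1 A B C f \<R> \<longleftrightarrow>
     (\<forall>R\<in>\<R>. mono1_box A B C f R) \<and>
     {(x, y, z). x \<in> A \<and> y \<in> B \<and> z \<in> C \<and> f x y z = 1} \<subseteq> \<Union>\<R>"

(* Meaningful when A, B, C are finite: the singleton boxes then form a finite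
   1-cover, so the minimum is attained.  Finiteness of the cover is required
   explicitly because the cardinality of an infinite set is 0. *)

definition cover1_number ::
  "'a set \<Rightarrow> 'b set \<Rightarrow> 'c set \<Rightarrow> ('a \<Rightarrow> 'b \<Rightarrow> 'c \<Rightarrow> nat) \<Rightarrow> nat" where
  "cover1_number A B C f =
     (LEAST k. \<exists>\<R>. finite \<R> \<and> cover1 A B C f \<R> \<and> card \<R> = k)"

definition nondet_cc ::
  "'a set \<Rightarrow> 'b set \<Rightarrow> 'c set \<Rightarrow> ('a \<Rightarrow> 'b \<Rightarrow> 'c \<Rightarrow> nat) \<Rightarrow> real" where
  "nondet_cc A B C f = log 2 (real (cover1_number A B C f))"

end

theory Submission
  imports Defs "HOL-Library.FuncSet"
begin

text \<open>
  Start from the Cayley table of the elementary abelian group on the numbers below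
  \<open>2 ^ n\<close> (bitwise exclusive or) and flip the lowest bit of the entries at will, the flip
  depending only on the higher bits of row and column; every set \<open>S\<close> of flipped places again
  gives a Latin square.  If \<open>z\<close> is wrong in a higher bit, that bit of \<open>x\<close>, \<open>y\<close>, \<open>z\<close>
  witnesses it; if it is wrong in the lowest bit, announcing \<open>x\<close> and one further bit suffices.
  This is a cover with at most \<open>4 * n + 2 * 2 ^ n\<close> boxes.
  Conversely, with \<open>m = 2 ^ n\<close> there are \<open>2 ^ (m\<^sup>2 / 4)\<close> sets \<open>S\<close>, each recoverable from any
  cover of its function, but at most \<open>2 ^ (3 * m * k)\<close> unions of \<open>k\<close> boxes; hence some \<open>S\<close>
  requires at least \<open>m / 12\<close> boxes.
\<close>

section \<open>The flipped xor table, bit by bit, and its Latin property\<close>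

lemma nat_less_exp_iff_bits: "(a::nat) < 2 ^ n \<longleftrightarrow> (\<forall>i\<ge>n. \<not> bit a i)"
proof
  assume "a < 2 ^ n"
  then have "take_bit n a = a" by (simp add: take_bit_nat_eq_self_iff)
  then show "\<forall>i\<ge>n. \<not> bit a i" by (metis bit_take_bit_iff not_le)
next
  assume "\<forall>i\<ge>n. \<not> bit a i"
  then have "take_bit n a = a" by (auto simp: bit_eq_iff bit_take_bit_iff not_le[symmetric])
  then show "a < 2 ^ n" by (simp add: take_bit_nat_eq_self_iff)
qed

text \<open>Since the flip depends only on \<open>u div 2\<close> and \<open>v div 2\<close>, it is
  constant on each aligned 2 by 2 block. Such a block of the xor table is a Latin subsquare on two
  symbols differing in the lowest bit, and flipping swaps these two symbols.\<close>

definition flipped_xor :: "(nat \<times> nat) set \<Rightarrow> nat \<Rightarrow> nat \<Rightarrow> nat" where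
  "flipped_xor S u v =
     Bit_Operations.xor (Bit_Operations.xor u v) (of_bool ((u div 2, v div 2) \<in> S))"

lemma bit_flipped_xor:
  "bit (flipped_xor S u v) i \<longleftrightarrow>
     (bit u i \<noteq> bit v i) \<noteq> (i = 0 \<and> (u div 2, v div 2) \<in> S)"
  by (auto simp: flipped_xor_def bit_xor_iff bit_of_bool_iff)

lemma even_flipped_xor:
  "even (flipped_xor S u v) \<longleftrightarrow> (even u = even v) = ((u div 2, v div 2) \<notin> S)"
  using bit_flipped_xor[of S u v 0] by (auto simp: bit_0)

lemma flipped_xor_less:
  assumes "u < 2 ^ n" "v < 2 ^ n" "0 < n"
  shows "flipped_xor S u v < 2 ^ n"
  using assms by (auto simp: nat_less_exp_iff_bits bit_flipped_xor)

lemma div2_eq_if_bits: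
  assumes "\<And>i. bit (u::nat) (Suc i) = bit v (Suc i)"
  shows "u div 2 = v div 2"
  using assms by (auto simp: bit_eq_iff bit_Suc)

text \<open>Above the lowest bit the entry is a plain xor, so the column is first recovered up to
  its lowest bit. Both entries then undergo the same flip, and the lowest bits can be cancelled as
  well.\<close>

lemma flipped_xor_cancel_left:
  assumes "flipped_xor S u v = flipped_xor S u w"
  shows "v = w"
proof -
  have b: "bit (flipped_xor S u v) i = bit (flipped_xor S u w) i" for i
    using assms by simp
  have "v div 2 = w div 2"
    by (rule div2_eq_if_bits) (use b[of "Suc _"] in \<open>auto simp: bit_flipped_xor\<close>)
  show ?thesis
  proof (rule bit_eqI)
    show "bit v i = bit w i" for i
      using b[of i] \<open>v div 2 = w div 2\<close> unfolding bit_flipped_xor by auto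
  qed
qed

lemma flipped_xor_cancel_right:
  assumes "flipped_xor S u w = flipped_xor S v w"
  shows "u = v"
proof -
  have b: "bit (flipped_xor S u w) i = bit (flipped_xor S v w) i" for i
    using assms by simp
  have "u div 2 = v div 2"
    by (rule div2_eq_if_bits) (use b[of "Suc _"] in \<open>auto simp: bit_flipped_xor\<close>)
  show ?thesis
  proof (rule bit_eqI)
    show "bit u i = bit v i" for i
      using b[of i] \<open>u div 2 = v div 2\<close> unfolding bit_flipped_xor by auto
  qed
qed

text \<open>Bits live on the numbers below m, while \<open>latin_square\<close> ranges over
  \<open>{1..m}\<close>; hence the shift by one.\<close>

definition flipped_square :: "(nat \<times> nat) set \<Rightarrow> nat \<Rightarrow> nat \<Rightarrow> nat" where
  "flipped_square S x y = Suc (flipped_xor S (x - 1) (y - 1))"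

lemma flipped_square_in_range:
  assumes "0 < n" "x \<in> {1..2 ^ n}" "y \<in> {1..2 ^ n}"
  shows "flipped_square S x y \<in> {1..2 ^ n}"
proof -
  have "x - 1 < 2 ^ n" "y - 1 < 2 ^ n" using assms by auto
  then show ?thesis
    using flipped_xor_less[of "x - 1" n "y - 1" S] assms(1)
    by (simp add: flipped_square_def Suc_le_eq)
qed

lemma latin_square_flipped_square:
  assumes "0 < n"
  shows "latin_square (2 ^ n) (flipped_square S)"
proof -
  have "bij_betw (\<lambda>y. flipped_square S x y) {1..2 ^ n} {1..2 ^ n}" if "x \<in> {1..2 ^ n}" for x
  proof -
    have "inj_on (\<lambda>y. flipped_square S x y) {1..2 ^ n}"
      by (rule inj_onI) (auto simp: flipped_square_def dest!: flipped_xor_cancel_left)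
    moreover have "(\<lambda>y. flipped_square S x y) ` {1..2 ^ n} \<subseteq> {1..2 ^ n}"
      using flipped_square_in_range[OF assms that] by blast
    ultimately show ?thesis
      by (simp add: bij_betw_def endo_inj_surj)
  qed
  moreover have "bij_betw (\<lambda>x. flipped_square S x y) {1..2 ^ n} {1..2 ^ n}"
    if "y \<in> {1..2 ^ n}" for y
  proof -
    have "inj_on (\<lambda>x. flipped_square S x y) {1..2 ^ n}"
      by (rule inj_onI) (auto simp: flipped_square_def dest!: flipped_xor_cancel_right)
    moreover have "(\<lambda>x. flipped_square S x y) ` {1..2 ^ n} \<subseteq> {1..2 ^ n}"
      using flipped_square_in_range[OF assms _ that] by blast
    ultimately show ?thesis
      by (simp add: bij_betw_def endo_inj_surj)
  qed
  ultimately show ?thesis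
    by (simp add: latin_square_def)
qed

section \<open>Covers by boxes, and the upper bound\<close>

lemma cover1_number_le_card:
  assumes "finite \<R>" "cover1 A B C f \<R>"
  shows "cover1_number A B C f \<le> card \<R>"
  unfolding cover1_number_def using assms by (auto intro: Least_le)

lemma minimal_cover1E:
  assumes "finite \<R>" "cover1 A B C f \<R>"
  obtains \<R>' where "finite \<R>'" "cover1 A B C f \<R>'" "card \<R>' = cover1_number A B C f"
proof -
  have "\<exists>\<R>'. finite \<R>' \<and> cover1 A B C f \<R>' \<and> card \<R>' = cover1_number A B C f"
    unfolding cover1_number_def by (rule LeastI) (use assms in blast)
  then show thesis using that by blast
qed

lemma mono1_boxI:
  assumes "X \<subseteq> A" "Y \<subseteq> B" "Z \<subseteq> C"
    and "\<And>x y z. (x, y, z) \<in> X \<times> Y \<times> Z \<Longrightarrow> f x y z = 1"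
  shows "mono1_box A B C f (X \<times> Y \<times> Z)"
  unfolding mono1_box_def using assms by blast

lemma latin_fun_eq_1_iff: "latin_fun L x y z = 1 \<longleftrightarrow> L x y \<noteq> z"
  by (simp add: latin_fun_def)

text \<open>Boxes of a cover contain no zero of the function, so their union is exactly its set of
  ones. This is what lets a cover encode the square.\<close>

lemma Union_cover1_latin_fun:
  assumes "cover1 A B C (latin_fun L) \<R>"
  shows "\<Union>\<R> = {(x, y, z). x \<in> A \<and> y \<in> B \<and> z \<in> C \<and> L x y \<noteq> z}"
proof -
  have "R \<subseteq> {(x, y, z). x \<in> A \<and> y \<in> B \<and> z \<in> C \<and> L x y \<noteq> z}" if "R \<in> \<R>" for R
  proof -
    have "mono1_box A B C (latin_fun L) R" using assms that by (simp add: cover1_def)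
    then obtain X Y Z where sub: "X \<subseteq> A" "Y \<subseteq> B" "Z \<subseteq> C" and R: "R = X \<times> Y \<times> Z"
      and one: "\<forall>(x, y, z)\<in>R. latin_fun L x y z = 1"
      unfolding mono1_box_def by blast
    have "L x y \<noteq> z" if "(x, y, z) \<in> R" for x y z
      using bspec[OF one that] unfolding split_conv latin_fun_eq_1_iff .
    then show ?thesis using sub unfolding R by blast
  qed
  moreover have "{(x, y, z). x \<in> A \<and> y \<in> B \<and> z \<in> C \<and> L x y \<noteq> z} \<subseteq> \<Union>\<R>"
    using assms unfolding cover1_def latin_fun_eq_1_iff by blast
  ultimately show ?thesis by blast
qed

text \<open>Besides the upper bound, this supplies the finite cover that makes the minimum attained
  in the counting argument.\<close>

lemma flipped_square_small_cover:
  assumes "0 < n"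
  obtains \<R> where "finite \<R>"
    "cover1 {1..2 ^ n} {1..2 ^ n} {1..2 ^ n} (latin_fun (flipped_square S)) \<R>"
    "card \<R> \<le> 4 * n + 2 * 2 ^ n"
proof -
  define I where "I = {1..(2::nat) ^ n}"
  \<comment> \<open>For a position \<open>i > 0\<close>, \<open>a\<close> and \<open>b\<close> are
    the announced bits of row and column, whose xor is the correct bit: four boxes per
    position.\<close>
  define F where "F = (\<lambda>(i, a, b). {x\<in>I. bit (x - 1) i = a} \<times> {y\<in>I. bit (y - 1) i = b} \<times>
    {z\<in>I. bit (z - 1) i \<noteq> (a \<noteq> b)})"
  \<comment> \<open>Once \<open>x\<close> is announced, the owner of \<open>y\<close> knows the
    flip. So \<open>b\<close> is the lowest bit of \<open>y - 1\<close> corrected by the flip, and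
    xor with the lowest bit of \<open>x - 1\<close> gives the correct lowest bit: two boxes per
    row.\<close>
  define G where "G = (\<lambda>(x, b). {x} \<times>
    {y\<in>I. (odd (y - 1) \<noteq> (((x - 1) div 2, (y - 1) div 2) \<in> S)) = b} \<times>
    {z\<in>I. odd (z - 1) \<noteq> (odd (x - 1) \<noteq> b)})"
  define IF where "IF = {1..<n} \<times> (UNIV :: (bool \<times> bool) set)"
  define IG where "IG = I \<times> (UNIV :: bool set)"
  define \<R> where "\<R> = F ` IF \<union> G ` IG"
  have fin: "finite IF" "finite IG"
    by (simp_all add: IF_def IG_def I_def)
  have "card \<R> \<le> card IF + card IG"
    unfolding \<R>_def using fin by (meson card_Un_le card_image_le add_mono order_trans)
  also have "\<dots> \<le> 4 * n + 2 * 2 ^ n"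
    by (simp add: IF_def IG_def I_def card_cartesian_product UNIV_Times_UNIV[symmetric]
        del: UNIV_Times_UNIV)
  finally have card: "card \<R> \<le> 4 * n + 2 * 2 ^ n" .
  have wrong: "latin_fun (flipped_square S) x y z = 1"
    if "bit (z - 1) i \<noteq> bit (flipped_xor S (x - 1) (y - 1)) i" for x y z i
    using that
    by (auto simp: latin_fun_def flipped_square_def)
  have monoF: "mono1_box I I I (latin_fun (flipped_square S)) (F p)" if "p \<in> IF" for p
  proof -
    obtain i a b where p: "p = (i, a, b)" by (cases p)
    have "i \<noteq> 0" using that by (auto simp: p IF_def)
    then have "bit (z - 1) i \<noteq> bit (flipped_xor S (x - 1) (y - 1)) i"
      if "(x, y, z) \<in> F p" for x y z
      using that by (auto simp: p F_def bit_flipped_xor)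
    then have "latin_fun (flipped_square S) x y z = 1" if "(x, y, z) \<in> F p" for x y z
      using that wrong by blast
    then show ?thesis
      unfolding p F_def split_conv by (intro mono1_boxI) auto
  qed
  have monoG: "mono1_box I I I (latin_fun (flipped_square S)) (G p)" if "p \<in> IG" for p
  proof -
    obtain x b where p: "p = (x, b)" by (cases p)
    have "x \<in> I" using that by (auto simp: p IG_def)
    have "bit (z - 1) 0 \<noteq> bit (flipped_xor S (x' - 1) (y - 1)) 0"
      if "(x', y, z) \<in> G p" for x' y z
      using that by (auto simp: p G_def bit_0 even_flipped_xor)
    then have "latin_fun (flipped_square S) x' y z = 1" if "(x', y, z) \<in> G p" for x' y z
      using that wrong by blast
    then show ?thesis
      unfolding p G_def split_conv using \<open>x \<in> I\<close> by (intro mono1_boxI) auto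
  qed
  have covered: "(x, y, z) \<in> \<Union>\<R>"
    if I: "x \<in> I" "y \<in> I" "z \<in> I" and ne: "flipped_square S x y \<noteq> z" for x y z
  proof -
    \<comment> \<open>Membership in \<open>I\<close> excludes \<open>z = 0\<close>, so the truncated
      subtraction loses nothing.\<close>
    have "flipped_xor S (x - 1) (y - 1) \<noteq> z - 1"
      using ne I by (auto simp: flipped_square_def I_def)
    then obtain i where i: "bit (z - 1) i \<noteq> bit (flipped_xor S (x - 1) (y - 1)) i"
      by (auto simp: bit_eq_iff)
    have "z - 1 < 2 ^ n" "flipped_xor S (x - 1) (y - 1) < 2 ^ n"
      using I flipped_square_in_range[OF assms, of x y S]
      by (auto simp: I_def flipped_square_def)
    then have "i < n"
      using i by (meson nat_less_exp_iff_bits not_le)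
    show ?thesis
    proof (cases "i = 0")
      case True
      let ?b = "odd (y - 1) \<noteq> (((x - 1) div 2, (y - 1) div 2) \<in> S)"
      have "(x, y, z) \<in> G (x, ?b)"
        using I i by (auto simp: G_def True bit_0 even_flipped_xor)
      moreover have "(x, ?b) \<in> IG" using I by (simp add: IG_def)
      ultimately show ?thesis unfolding \<R>_def by blast
    next
      case False
      have "(x, y, z) \<in> F (i, bit (x - 1) i, bit (y - 1) i)"
        using I i False by (auto simp: F_def bit_flipped_xor)
      moreover have "(i, bit (x - 1) i, bit (y - 1) i) \<in> IF"
        using False \<open>i < n\<close> by (simp add: IF_def)
      ultimately show ?thesis unfolding \<R>_def by blast
    qed
  qed
  have "cover1 I I I (latin_fun (flipped_square S)) \<R>"
    unfolding cover1_def
  proof (intro conjI ballI subsetI)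
    show "mono1_box I I I (latin_fun (flipped_square S)) R" if "R \<in> \<R>" for R
      using that monoF monoG unfolding \<R>_def by blast
    show "t \<in> \<Union>\<R>"
      if "t \<in> {(x, y, z). x \<in> I \<and> y \<in> I \<and> z \<in> I \<and> latin_fun (flipped_square S) x y z = 1}" for t
      using that covered by (auto simp: latin_fun_def split: if_splits)
  qed
  moreover have "finite \<R>" using fin by (simp add: \<R>_def)
  ultimately show thesis
    using that card unfolding I_def by blast
qed

section \<open>The lower bound by counting\<close>

lemma card_Unions_le:
  assumes fin: "finite \<B>" and empty: "{} \<in> \<B>"
  shows "card {\<Union>\<R> | \<R>. \<R> \<subseteq> \<B> \<and> card \<R> \<le> k} \<le> card \<B> ^ k"
proof -
  have "{\<Union>\<R> | \<R>. \<R> \<subseteq> \<B> \<and> card \<R> \<le> k} \<subseteq> (\<lambda>g. \<Union>(g ` {..<k})) ` ({..<k} \<rightarrow>\<^sub>E \<B>)"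
  proof clarify
    fix \<R> assume \<R>: "\<R> \<subseteq> \<B>" "card \<R> \<le> k"
    then have "finite \<R>" using fin finite_subset by blast
    then obtain e where e: "bij_betw e {..<card \<R>} \<R>"
      using ex_bij_betw_nat_finite by (metis atLeast0LessThan)
    \<comment> \<open>An enumeration of the family is padded with the empty set to length exactly
      \<open>k\<close>, so that counting functions from \<open>{..<k}\<close> suffices.\<close>
    define g where "g = (\<lambda>i\<in>{..<k}. if i < card \<R> then e i else {})"
    have "g \<in> {..<k} \<rightarrow>\<^sub>E \<B>"
      using bij_betwE[OF e] \<R>(1) empty by (auto simp: g_def subset_iff)
    moreover have "\<Union>\<R> = \<Union>(g ` {..<k})"
    proof -
      have "\<Union>(g ` {..<k}) = \<Union>(e ` {..<card \<R>})"
        using \<R>(2) by (auto simp: g_def Bex_def intro: less_le_trans)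
      then show ?thesis by (simp add: bij_betw_imp_surj_on[OF e])
    qed
    ultimately show "\<Union>\<R> \<in> (\<lambda>g. \<Union>(g ` {..<k})) ` ({..<k} \<rightarrow>\<^sub>E \<B>)" by blast
  qed
  moreover have "finite ({..<k} \<rightarrow>\<^sub>E \<B>)" using fin by (simp add: finite_PiE)
  ultimately have "card {\<Union>\<R> | \<R>. \<R> \<subseteq> \<B> \<and> card \<R> \<le> k} \<le> card ({..<k} \<rightarrow>\<^sub>E \<B>)"
    by (rule surj_card_le[rotated])
  then show ?thesis by (simp add: card_PiE)
qed

text \<open>At the even representatives \<open>2 * u\<close> and \<open>2 * v\<close> of a block
  both lowest bits vanish, so the parity of the entry is the flip itself.\<close>

lemma flipped_square_determines_flips:
  assumes S: "S \<subseteq> {..<2 ^ k} \<times> {..<2 ^ k}" and T: "T \<subseteq> {..<2 ^ k} \<times> {..<2 ^ k}"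
    and eq: "\<And>x y. x \<in> {1..2 ^ Suc k} \<Longrightarrow> y \<in> {1..2 ^ Suc k} \<Longrightarrow>
      flipped_square S x y = flipped_square T x y"
  shows "S = T"
proof -
  have "(u, v) \<in> S \<longleftrightarrow> (u, v) \<in> T" if "u < 2 ^ k" "v < 2 ^ k" for u v
  proof -
    have "flipped_xor S (2 * u) (2 * v) = flipped_xor T (2 * u) (2 * v)"
      using eq[of "Suc (2 * u)" "Suc (2 * v)"] that by (simp add: flipped_square_def)
    then have "even (flipped_xor S (2 * u) (2 * v)) = even (flipped_xor T (2 * u) (2 * v))"
      by simp
    then show ?thesis by (simp add: even_flipped_xor)
  qed
  then show ?thesis using S T by auto
qed

lemma exists_flips_with_large_cover_number:
  assumes "0 < n"
  shows "\<exists>S. 2 ^ n \<le>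
    12 * cover1_number {1..2 ^ n} {1..2 ^ n} {1..2 ^ n} (latin_fun (flipped_square S))"
proof (rule ccontr)
  define I where "I = {1..(2::nat) ^ n}"
  assume "\<nexists>S. 2 ^ n \<le>
    12 * cover1_number {1..2 ^ n} {1..2 ^ n} {1..2 ^ n} (latin_fun (flipped_square S))"
  then have small: "12 * cover1_number I I I (latin_fun (flipped_square S)) < 2 ^ n" for S
    by (auto simp: not_le I_def)
  \<comment> \<open>The largest \<open>k\<close> with 12k < m, where m = \<open>2 ^ n\<close>; by
    assumption it bounds all cover numbers.\<close>
  define k where "k = (2 ^ n - 1) div (12::nat)"
  have "12 * k \<le> 2 ^ n - 1" unfolding k_def by (rule times_div_less_eq_dividend)
  moreover have "(0::nat) < 2 ^ n" by simp
  ultimately have k: "12 * k < 2 ^ n" by linarith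
  define \<B> where "\<B> = (\<lambda>(X, Y, Z). X \<times> Y \<times> Z) ` (Pow I \<times> Pow I \<times> Pow I)"
  have finB: "finite \<B>" by (simp add: \<B>_def I_def)
  have "card \<B> \<le> card (Pow I \<times> Pow I \<times> Pow I)"
    unfolding \<B>_def by (rule card_image_le) (simp add: I_def)
  also have "\<dots> = (2 ^ 2 ^ n) ^ 3"
    by (simp add: card_cartesian_product card_Pow I_def power3_eq_cube)
  also have "\<dots> = 2 ^ (3 * 2 ^ n)"
    by (simp only: power_mult[symmetric] mult.commute)
  finally have cardB: "card \<B> \<le> 2 ^ (3 * 2 ^ n)" .
  have emptyB: "{} \<in> \<B>" by (auto simp: \<B>_def image_iff)
  define U where "U = (\<lambda>S. {(x, y, z). x \<in> I \<and> y \<in> I \<and> z \<in> I \<and> flipped_square S x y \<noteq> z})"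
  obtain j where j: "n = Suc j" using assms by (cases n) auto
  \<comment> \<open>Blocks are indexed by pairs below m/2 = \<open>2 ^ j\<close>, so there are m^2/4
    independent flips.\<close>
  define P where "P = Pow ({..<(2::nat) ^ j} \<times> {..<(2::nat) ^ j})"
  have "inj_on U P"
  proof (rule inj_onI)
    fix S T assume S: "S \<in> P" and T: "T \<in> P" and eq: "U S = U T"
    have "flipped_square S x y = flipped_square T x y" if "x \<in> I" "y \<in> I" for x y
    proof -
      have "flipped_square T x y \<in> I"
        using flipped_square_in_range[OF assms] that unfolding I_def by blast
      \<comment> \<open>The entry of the square for \<open>T\<close> is the one third coordinate
        missing from \<open>U T = U S\<close>, which forces the entry for \<open>S\<close> to equal
        it.\<close>
      moreover have "(x, y, flipped_square T x y) \<notin> U T" by (simp add: U_def)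
      ultimately show ?thesis using that unfolding eq[symmetric] by (simp add: U_def)
    qed
    then show "S = T"
      using S T by (intro flipped_square_determines_flips[of S j T]) (auto simp: P_def I_def j)
  qed
  then have "card P = card (U ` P)" by (simp add: card_image)
  also have "\<dots> \<le> card {\<Union>\<R> | \<R>. \<R> \<subseteq> \<B> \<and> card \<R> \<le> k}"
  proof (rule card_mono)
    have "{\<Union>\<R> | \<R>. \<R> \<subseteq> \<B> \<and> card \<R> \<le> k} \<subseteq> Union ` Pow \<B>" by blast
    then show "finite {\<Union>\<R> | \<R>. \<R> \<subseteq> \<B> \<and> card \<R> \<le> k}"
      using finB by (meson finite_Pow_iff finite_imageI finite_subset)
    show "U ` P \<subseteq> {\<Union>\<R> | \<R>. \<R> \<subseteq> \<B> \<and> card \<R> \<le> k}"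
    proof clarify
      fix S
      obtain \<R>0 where "finite \<R>0" "cover1 I I I (latin_fun (flipped_square S)) \<R>0"
        using flipped_square_small_cover[OF assms] unfolding I_def by blast
      then obtain \<R> where \<R>: "cover1 I I I (latin_fun (flipped_square S)) \<R>"
        "card \<R> = cover1_number I I I (latin_fun (flipped_square S))"
        by (rule minimal_cover1E)
      have "\<R> \<subseteq> \<B>"
      proof
        fix R assume "R \<in> \<R>"
        then have "mono1_box I I I (latin_fun (flipped_square S)) R"
          using \<R>(1) by (simp add: cover1_def)
        then obtain X Y Z where "X \<subseteq> I" "Y \<subseteq> I" "Z \<subseteq> I" "R = X \<times> Y \<times> Z"
          unfolding mono1_box_def by blast
        then show "R \<in> \<B>"
          unfolding \<B>_def by (intro image_eqI[of _ _ "(X, Y, Z)"]) auto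
      qed
      moreover have "card \<R> \<le> k"
        using small[of S] \<R>(2) by (simp add: k_def less_eq_div_iff_mult_less_eq)
      moreover have "U S = \<Union>\<R>"
        using Union_cover1_latin_fun[OF \<R>(1)] by (simp add: U_def)
      ultimately show "\<exists>\<R>. U S = \<Union>\<R> \<and> \<R> \<subseteq> \<B> \<and> card \<R> \<le> k" by blast
    qed
  qed
  also have "\<dots> \<le> card \<B> ^ k" by (rule card_Unions_le[OF finB emptyB])
  also have "\<dots> \<le> (2 ^ (3 * 2 ^ n)) ^ k" by (rule power_mono[OF cardB]) simp
  also have "\<dots> = 2 ^ (3 * 2 ^ n * k)" by (simp add: power_mult)
  finally have "(2::nat) ^ (2 ^ j * 2 ^ j) \<le> 2 ^ (3 * 2 ^ n * k)"
    by (simp add: P_def card_Pow card_cartesian_product)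
  then have "(2::nat) ^ j * 2 ^ j \<le> 3 * 2 ^ n * k" by (rule power_le_imp_le_exp[rotated]) simp
  \<comment> \<open>Cancelling \<open>2 ^ j\<close> = m/2 leaves m/2 \<le> 6k, against 12k < m. The
    12 is the product of 3 sides per box and the 4 from m^2/4 flips.\<close>
  then have "(2::nat) ^ j * 2 ^ j \<le> 2 ^ j * (6 * k)" by (simp add: j algebra_simps)
  then have "2 ^ j \<le> 6 * k" by simp
  then show False using k by (simp add: j)
qed

theorem theorem6:
  "\<exists>c::real. \<forall>n::nat. n > 0 \<longrightarrow>
     (\<exists>L. latin_square (2 ^ n) L \<and>
        \<bar>nondet_cc {1..2 ^ n} {1..2 ^ n} {1..2 ^ n} (latin_fun L) - real n\<bar> \<le> c)"
proof (intro exI[of _ 4] allI impI)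
  fix n :: nat assume n: "0 < n"
  obtain S where S: "2 ^ n \<le>
    12 * cover1_number {1..2 ^ n} {1..2 ^ n} {1..2 ^ n} (latin_fun (flipped_square S))"
    using exists_flips_with_large_cover_number[OF n] by blast
  define N where
    "N = cover1_number {1..2 ^ n} {1..2 ^ n} {1..2 ^ n} (latin_fun (flipped_square S))"
  obtain \<R> where \<R>: "finite \<R>"
    "cover1 {1..2 ^ n} {1..2 ^ n} {1..2 ^ n} (latin_fun (flipped_square S)) \<R>"
    "card \<R> \<le> 4 * n + 2 * 2 ^ n"
    using flipped_square_small_cover[OF n] .
  have "N \<le> card \<R>" unfolding N_def by (rule cover1_number_le_card[OF \<R>(1,2)])
  also note \<R>(3)
  \<comment> \<open>As n < \<open>2 ^ n\<close>, the cover has at most 6 * \<open>2 ^ n\<close>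
    boxes. Both this 6 and the 12 of the lower bound are rounded up to 16 = 2^4, whence the constant
    4.\<close>
  finally have "N \<le> 16 * 2 ^ n" using less_exp[of n] by linarith
  then have "real N \<le> real (16 * 2 ^ n)" by (rule of_nat_mono)
  then have upper: "real N \<le> 2 powr (4 + real n)"
    by (simp add: powr_add powr_realpow)
  have "real (2 ^ n) \<le> real (16 * N)" using S unfolding N_def[symmetric] by (intro of_nat_mono) simp
  then have lower: "2 powr (real n - 4) \<le> real N"
    by (simp add: powr_diff powr_realpow)
  have "0 < N" using lower by (cases "N = 0") auto
  then have "log 2 (real N) \<le> 4 + real n" "real n - 4 \<le> log 2 (real N)"
    using upper lower by (simp_all add: log_le_iff le_log_iff)
  then have "\<bar>nondet_cc {1..2 ^ n} {1..2 ^ n} {1..2 ^ n} (latin_fun (flipped_square S)) - real n\<bar> \<le> 4"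
    by (simp add: nondet_cc_def N_def)
  then show "\<exists>L. latin_square (2 ^ n) L \<and>
      \<bar>nondet_cc {1..2 ^ n} {1..2 ^ n} {1..2 ^ n} (latin_fun L) - real n\<bar> \<le> 4"
    using latin_square_flipped_square[OF n] by blast
qed

end
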